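(* Let $X$ be a separable Fréchet space and let $T$ be a continuous linear operator on $X$. Suppose that there are a dense subset $X_0$ of $X$ and a map $S:X_0\to X_0$ such that, for every $x\in X_0$, (i) $\sum_{n=0}^{+\infty}T^nx$ converges unconditionally, (ii) $\sum_{n=0}^{+\infty}S^nx$ converges unconditionally, (iii) $TSx=x$. Then $T$ is $B_2$-frequently hypercyclic.
   Context: $\mathbb{N}$ is the set of positive integers. For a non-negative sequence $(\alpha_k)_{k\ge1}$ with $\sum_{k}\alpha_k=+\infty$, the associated admissible matrix is $A=(\alpha_k/\sum_{j=1}^n\alpha_j)$, i.e. the infinite matrix $(\alpha_{n,k})$ with $\alpha_{n,k}=\alpha_k/\sum_{j=1}^n\alpha_j$ for $1\le k\le n$ and $\alpha_{n,k}=0$ for $k>n$. The lower $A$-density of $E\subset\mathbb{N}$ is $$\underline{d}_A(E)=\liminf_{n\to+\infty}\frac{\sum_{k\le n,\,k\in E}\alpha_k}{\sum_{j=1}^n\alpha_j}.$$ $B_2$ is the admissible matrix associated with $\alpha_1=1$ and $\alpha_k=e^{k/(\log k)^2}$ for $k\ge2$. A continuous linear operator $T$ on $X$ is $A$-frequently hypercyclic if there is $x\in X$ such that for every non-empty open set $U\subset X$, the set $N(x,U)=\{n\in\mathbb{N}:T^nx\in U\}$ satisfies $\underline{d}_A(N(x,U))>0$. *)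

theory Defs
  imports "HOL-Analysis.Analysis"
begin

section \<open>Frechet spaces\<close>

definition seminorm :: "('k::real_normed_field \<Rightarrow> 'a::ab_group_add \<Rightarrow> 'a) \<Rightarrow> ('a \<Rightarrow> real) \<Rightarrow> bool" where
  "seminorm scl p \<longleftrightarrow>
     (\<forall>x. 0 \<le> p x) \<and>
     (\<forall>x y. p (x + y) \<le> p x + p y) \<and>
     (\<forall>c x. p (scl c x) = norm c * p x)"

text \<open>The scalar field is any \<open>real_normed_field\<close>; up to isomorphism these are the real and the
  complex numbers. The space is the whole type, with the topology supplied by the type class
  \<open>topological_space\<close>; the locale says that it is a Hausdorff topology generated by countably many
  seminorms and that it is complete. Since finite maxima are taken in the description of the open
  sets, the family of seminorms need not be increasing.\<close>

locale frechet_space = vector_space scl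
  for scl :: "'k::real_normed_field \<Rightarrow> 'a::{ab_group_add,topological_space} \<Rightarrow> 'a" +
  assumes seminorms:
    "\<exists>p :: nat \<Rightarrow> 'a \<Rightarrow> real.
       (\<forall>i. seminorm scl (p i)) \<and>
       (\<forall>U. open U \<longleftrightarrow> (\<forall>x\<in>U. \<exists>n. \<exists>e>0. \<forall>y. (\<forall>i\<le>n. p i (y - x) < e) \<longrightarrow> y \<in> U)) \<and>
       (\<forall>x. (\<forall>i. p i x = 0) \<longrightarrow> x = 0) \<and>
       (\<forall>u :: nat \<Rightarrow> 'a.
          (\<forall>i. \<forall>e>0. \<exists>N. \<forall>m\<ge>N. \<forall>n\<ge>N. p i (u m - u n) < e) \<longrightarrow> (\<exists>l. u \<longlonglongrightarrow> l))"


section \<open>Admissible matrices and lower densities\<close>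

text \<open>Sequences and matrices are indexed by the positive integers; values at the index 0 are
  irrelevant.\<close>

definition admissible_weights :: "(nat \<Rightarrow> real) \<Rightarrow> bool" where
  "admissible_weights \<alpha> \<longleftrightarrow>
     (\<forall>k\<ge>1. 0 \<le> \<alpha> k) \<and> filterlim (\<lambda>n. \<Sum>k=1..n. \<alpha> k) at_top sequentially"

definition admissible_matrix :: "(nat \<Rightarrow> real) \<Rightarrow> nat \<Rightarrow> nat \<Rightarrow> real" where
  "admissible_matrix \<alpha> n k = (if 1 \<le> k \<and> k \<le> n then \<alpha> k / (\<Sum>j=1..n. \<alpha> j) else 0)"

text \<open>Only the entries with \<open>1 \<le> k \<le> n\<close> are used, since admissible matrices vanish elsewhere.\<close>

definition lower_density :: "(nat \<Rightarrow> nat \<Rightarrow> real) \<Rightarrow> nat set \<Rightarrow> ereal" where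
  "lower_density A E = liminf (\<lambda>n. ereal (\<Sum>k\<in>E \<inter> {1..n}. A n k))"

lemma lower_density_admissible_matrix:
  "lower_density (admissible_matrix \<alpha>) E =
     liminf (\<lambda>n. ereal ((\<Sum>k\<in>E \<inter> {1..n}. \<alpha> k) / (\<Sum>j=1..n. \<alpha> j)))"
  unfolding lower_density_def
  by (intro arg_cong[where f = liminf] ext)
     (auto simp: admissible_matrix_def sum_divide_distrib intro!: sum.cong)

definition B2_weight :: "nat \<Rightarrow> real" where
  "B2_weight k = (if k \<ge> 2 then exp (real k / (ln (real k))\<^sup>2) else 1)"

lemma admissible_weights_B2: "admissible_weights B2_weight"
proof -
  have ge: "1 \<le> B2_weight k" for k
    by (simp add: B2_weight_def)
  have "real n \<le> (\<Sum>k=1..n. B2_weight k)" for n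
    using sum_mono[of "{1..n}" "\<lambda>_. 1" B2_weight] ge by simp
  then have "filterlim (\<lambda>n. \<Sum>k=1..n. B2_weight k) at_top sequentially"
    by (intro filterlim_at_top_mono[OF filterlim_real_sequentially]) auto
  moreover have "0 \<le> B2_weight k" for k
    using ge[of k] by linarith
  ultimately show ?thesis
    by (simp add: admissible_weights_def)
qed

definition B2 :: "nat \<Rightarrow> nat \<Rightarrow> real" where
  "B2 = admissible_matrix B2_weight"


section \<open>Frequent hypercyclicity with respect to a matrix\<close>

definition return_set :: "('a \<Rightarrow> 'a) \<Rightarrow> 'a \<Rightarrow> 'a set \<Rightarrow> nat set" where
  "return_set T x U = {n. 1 \<le> n \<and> (T ^^ n) x \<in> U}"

definition frequently_hypercyclic ::
  "(nat \<Rightarrow> nat \<Rightarrow> real) \<Rightarrow> ('a::topological_space \<Rightarrow> 'a) \<Rightarrow> bool" where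
  "frequently_hypercyclic A T \<longleftrightarrow>
     (\<exists>x. \<forall>U. open U \<and> U \<noteq> {} \<longrightarrow> 0 < lower_density A (return_set T x U))"

end

theory Submission
  imports Defs "HOL-Real_Asymp.Real_Asymp"
begin

text \<open>
  Only three features of the weights \<open>\<alpha>\<close> matter: they are positive, their sum diverges, and
  \<open>\<alpha> (k + 1) / \<alpha> k\<close> tends to 1. The last one says that, for each fixed length, \<open>\<alpha>\<close> is constant up
  to a factor 2 on every interval of that length that lies far enough from the origin.
  A set therefore has positive lower density as soon as it has a fixed positive proportion in
  consecutive blocks whose length is allowed to tend to infinity, provided that the length grows
  slowly enough (\<open>sum_block_le\<close>, \<open>lower_density_E_pos\<close>).

  For any prescribed \<open>N\<close> this leaves room for disjoint sets \<open>E 0, E 1, \<dots>\<close> of positive lower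
  density such that every element of \<open>E p\<close> is at least \<open>N p\<close> and at distance at least \<open>N p\<close> from
  every other element of the union (\<open>separated_sets_of_positive_lower_density\<close>). The sets are
  built from a rapidly growing chain \<open>L 0 dvd L 1 dvd \<dots>\<close>: \<open>E p\<close> consists of integers congruent
  to \<open>L p\<close> modulo \<open>L (p + 1)\<close>, and the set \<open>E r\<close>, which starts at a threshold \<open>T r\<close>, reserves
  from there on the first \<open>2 * L r\<close> residues modulo \<open>L (r + 1)\<close>. The reserved proportions are
  summable and leave at least half of the original integers of \<open>E p\<close> in each block.

  The vector is then \<open>x = (\<Sum>q. \<Sum>m\<in>E q. (S ^^ m) (y q))\<close>, where \<open>y\<close> is a sequence in \<open>X0\<close> that
  visits every ball infinitely often. For \<open>n \<in> E p\<close> the term with \<open>m = n\<close> contributes \<open>y p\<close>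
  to \<open>(T ^^ n) x\<close>, and the terms with \<open>m < n\<close> and \<open>m > n\<close> form pieces of the tails of
  \<open>\<Sum>k. (T ^^ k) (y q)\<close> and \<open>\<Sum>k. (S ^^ k) (y q)\<close>, which the separation makes small
  (\<open>orbit_near_targets\<close>).
\<close>


section \<open>Weights with ratio tending to one\<close>

lemma ratio_shift_tendsto:
  fixes \<alpha> :: "nat \<Rightarrow> real"
  assumes pos: "\<And>k. 0 < \<alpha> k"
    and ratio: "(\<lambda>k. \<alpha> (Suc k) / \<alpha> k) \<longlonglongrightarrow> 1"
  shows "(\<lambda>k. \<alpha> (k + i) / \<alpha> k) \<longlonglongrightarrow> 1"
proof (induction i)
  case 0
  have "\<alpha> k \<noteq> 0" for k
    using pos[of k] by simp
  then show ?case by simp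
next
  case (Suc i)
  have "(\<lambda>k. (\<alpha> (Suc (k + i)) / \<alpha> (k + i)) * (\<alpha> (k + i) / \<alpha> k)) \<longlonglongrightarrow> 1 * 1"
    by (intro tendsto_mult Suc LIMSEQ_ignore_initial_segment[OF ratio])
  moreover have "(\<alpha> (Suc (k + i)) / \<alpha> (k + i)) * (\<alpha> (k + i) / \<alpha> k) = \<alpha> (k + Suc i) / \<alpha> k" for k
    using pos[of "k + i"] by (simp add: field_simps)
  ultimately show ?case by (simp only: mult_1)
qed

lemma eventually_comparable:
  fixes \<alpha> :: "nat \<Rightarrow> real"
  assumes pos: "\<And>k. 0 < \<alpha> k"
    and ratio: "(\<lambda>k. \<alpha> (Suc k) / \<alpha> k) \<longlonglongrightarrow> 1"
  shows "\<forall>\<^sub>F k in sequentially. \<forall>i\<in>{..M}. \<alpha> (k + i) \<le> 2 * \<alpha> k \<and> \<alpha> k \<le> 2 * \<alpha> (k + i)"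
proof (rule eventually_ball_finite, simp, rule ballI)
  fix i
  have lim: "(\<lambda>k. \<alpha> (k + i) / \<alpha> k) \<longlonglongrightarrow> 1"
    by (rule ratio_shift_tendsto[OF pos ratio])
  have "\<forall>\<^sub>F k in sequentially. \<alpha> (k + i) / \<alpha> k < 2"
    "\<forall>\<^sub>F k in sequentially. 1 / 2 < \<alpha> (k + i) / \<alpha> k"
    by (rule order_tendstoD[OF lim]; simp)+
  then show "\<forall>\<^sub>F k in sequentially. \<alpha> (k + i) \<le> 2 * \<alpha> k \<and> \<alpha> k \<le> 2 * \<alpha> (k + i)"
  proof eventually_elim
    case (elim k)
    then show ?case using pos[of k] by (simp add: field_simps)
  qed
qed

lemma B2_weight_pos: "0 < B2_weight k"
  by (simp add: B2_weight_def)

lemma B2_weight_ratio: "(\<lambda>k. B2_weight (Suc k) / B2_weight k) \<longlonglongrightarrow> 1"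
proof -
  have "(\<lambda>k. exp (real (Suc k) / (ln (real (Suc k)))\<^sup>2) / exp (real k / (ln (real k))\<^sup>2)) \<longlonglongrightarrow> 1"
    by real_asymp
  moreover have "\<forall>\<^sub>F k in sequentially.
      exp (real (Suc k) / (ln (real (Suc k)))\<^sup>2) / exp (real k / (ln (real k))\<^sup>2)
        = B2_weight (Suc k) / B2_weight k"
    using eventually_ge_at_top[of 2] by eventually_elim (simp add: B2_weight_def)
  ultimately show ?thesis
    by (rule Lim_transform_eventually)
qed


section \<open>Mutually separated sets of positive lower density\<close>

text \<open>
  \<open>L r\<close> are the block lengths, each a multiple of the preceding one; \<open>T r\<close> is the point from
  which the set with index \<open>r\<close> is present. Between \<open>T s\<close> and \<open>T (Suc s)\<close> the relevant blocks
  have length \<open>L (Suc s)\<close>, and \<open>T s\<close> is the left end of such a block.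
\<close>

locale block_scales =
  fixes L T :: "nat \<Rightarrow> nat"
  assumes L_pos: "0 < L r"
    and L_dvd: "L r dvd L (Suc r)"
    and L_growth: "2 ^ (r + 2) * L r \<le> L (Suc r)"
    and T_dvd: "L (Suc s) dvd T s"
    and T_ge: "L (Suc s) \<le> T s"
    and T_mono: "strict_mono T"
begin

text \<open>
  In a block of length \<open>L (Suc r)\<close> beyond \<open>T r\<close>, the only possible element that \<open>E r\<close> and the sets of
  smaller index have among the first \<open>2 * L r\<close> positions is the element of \<open>E r\<close> at position
  \<open>L r\<close>; it has a free interval of length \<open>L r\<close> on either side.
\<close>

definition E :: "nat \<Rightarrow> nat set" where
  "E p = {n. T p \<le> n \<and> n mod L (Suc p) = L p \<and> (\<forall>r>p. T r \<le> n \<longrightarrow> 2 * L r \<le> n mod L (Suc r))}"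

lemma L_double: "2 * L r \<le> L (Suc r)"
proof -
  have "2 * L r \<le> 2 ^ (r + 2) * L r"
    by (intro mult_right_mono) (simp_all add: self_le_power)
  then show ?thesis using L_growth[of r] by linarith
qed

lemma L_mono: "mono L"
  unfolding mono_iff_le_Suc using L_double by (metis le_add1 le_trans mult_2)

lemma le_L_diff:
  assumes "n < m" "n \<in> E p" "m \<in> E q"
  shows "L (max p q) \<le> m - n"
proof -
  consider "p = q" | "p < q" | "q < p" by linarith
  then show ?thesis
  proof cases
    case 1
    then have "n mod L (Suc p) = m mod L (Suc p)"
      using assms by (simp add: E_def)
    then have "L (Suc p) dvd m - n"
      using assms(1) by (metis mod_eq_dvd_iff_nat less_imp_le)
    then have "L (Suc p) \<le> m - n"
      using assms(1) by (intro dvd_imp_le) auto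
    then show ?thesis using 1 L_double[of p] by simp
  next
    case 2
    \<comment> \<open>the left end of the block of length \<open>L (Suc q)\<close> that contains \<open>m\<close>\<close>
    define b where "b = m - L q"
    have mq: "T q \<le> m" "m mod L (Suc q) = L q"
      using assms(3) by (auto simp: E_def)
    have m: "m = b + L q" "L (Suc q) dvd b"
      unfolding b_def using mq(2) by (metis le_add_diff_inverse2 mod_less_eq_dividend, metis dvd_minus_mod)
    have Tb: "T q \<le> b"
    proof (rule ccontr)
      assume "\<not> T q \<le> b"
      then have "L (Suc q) \<le> T q - b"
        using dvd_diff_nat[OF T_dvd[of q] m(2)] by (intro dvd_imp_le) auto
      then show False using mq m L_double[of q] L_pos[of q] by linarith
    qed
    \<comment> \<open>otherwise \<open>n\<close> would lie in the part of this block that is reserved for \<open>E q\<close>\<close>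
    have "n < b"
    proof (rule ccontr)
      assume "\<not> n < b"
      then have nb: "n = b + (n - b)" "n - b < L q" using m assms(1) by auto
      then have "T q \<le> n" using Tb by linarith
      then have "2 * L q \<le> n mod L (Suc q)"
        using assms(2) 2 by (auto simp: E_def)
      also have "n mod L (Suc q) = (n - b) mod L (Suc q)"
        using m(2) nb(1) by (metis mod_add_left_eq dvd_imp_mod_0 add_0)
      also have "\<dots> \<le> n - b" by simp
      finally show False using nb by linarith
    qed
    then show ?thesis using m 2 by simp
  next
    case 3
    define b where "b = n - L p"
    have np: "T p \<le> n" "n mod L (Suc p) = L p"
      using assms(2) by (auto simp: E_def)
    have n: "n = b + L p" "L (Suc p) dvd b"
      unfolding b_def using np(2) by (metis le_add_diff_inverse2 mod_less_eq_dividend, metis dvd_minus_mod)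
    have bm: "m = b + (m - b)" using n(1) assms(1) by simp
    have "2 * L p \<le> m mod L (Suc p)"
      using assms(1,3) 3 np by (auto simp: E_def)
    also have "m mod L (Suc p) = (m - b) mod L (Suc p)"
      using n(2) bm by (metis mod_add_left_eq dvd_imp_mod_0 add_0)
    also have "\<dots> \<le> m - b" by simp
    finally show ?thesis using n assms(1) 3 by simp
  qed
qed

lemma E_disjoint:
  assumes "n \<in> E p" "n \<in> E q"
  shows "p = q"
proof -
  have "\<not> a < b" if "n \<in> E a" "n \<in> E b" for a b
  proof
    assume "a < b"
    then have "2 * L b \<le> L b" using that by (auto simp: E_def)
    then show False using L_pos[of b] by simp
  qed
  then show ?thesis using assms by (meson linorder_neqE_nat)
qed

lemma le_L_of_E: "n \<in> E p \<Longrightarrow> L p \<le> n"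
  by (auto simp: E_def) (metis mod_less_eq_dividend)

text \<open>
  The set \<open>E p\<close> as it is seen between \<open>T s\<close> and \<open>T (Suc s)\<close>, extended periodically with period
  \<open>L (Suc s)\<close>.
\<close>

definition G :: "nat \<Rightarrow> nat \<Rightarrow> nat set" where
  "G p s = {n. n mod L (Suc p) = L p \<and> (\<forall>r\<in>{p<..s}. 2 * L r \<le> n mod L (Suc r))}"

text \<open>
  Induction on \<open>s\<close>: a block of the next scale consists of smaller blocks, of which the first two
  are reserved and all others carry the pattern of scale \<open>s\<close>.
\<close>

lemma card_G_block_aux:
  assumes "p \<le> s"
  shows "real (L (Suc s)) / L (Suc p) * (1 - (\<Sum>r\<in>{p<..s}. 2 * L r / L (Suc r)))
    \<le> card (G p s \<inter> {j * L (Suc s)..<j * L (Suc s) + L (Suc s)})"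
  using assms
proof (induction s arbitrary: j rule: dec_induct)
  case base
  have "j * L (Suc p) + L p \<in> G p p \<inter> {j * L (Suc p)..<j * L (Suc p) + L (Suc p)}"
    using L_double[of p] L_pos[of p] by (auto simp: G_def)
  then have "0 < card (G p p \<inter> {j * L (Suc p)..<j * L (Suc p) + L (Suc p)})"
    by (intro card_gt_0_iff[THEN iffD2]) auto
  then show ?case using L_pos[of "Suc p"] by simp
next
  case (step s)
  define \<sigma> where "\<sigma> = (\<Sum>r\<in>{p<..s}. 2 * L r / L (Suc r) :: real)"
  define B where "B = L (Suc s)"
  obtain m where m: "L (Suc (Suc s)) = B * m"
    using L_dvd[of "Suc s"] unfolding B_def by (elim dvdE)
  have B: "0 < B" using L_pos B_def by simp
  have m2: "2 \<le> m"
    using L_double[of "Suc s"] B unfolding m B_def[symmetric] by (simp add: mult.commute)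
  let ?W = "{j * (B * m)..<j * (B * m) + B * m}"
  let ?V = "\<lambda>i. G p s \<inter> {(j * m + i) * B..<(j * m + i) * B + B}"
  have sub: "(\<Union>i\<in>{2..<m}. ?V i) \<subseteq> G p (Suc s) \<inter> ?W"
  proof
    fix n assume "n \<in> (\<Union>i\<in>{2..<m}. ?V i)"
    then obtain i where i: "2 \<le> i" "i < m" "n \<in> G p s" "(j * m + i) * B \<le> n" "n < (j * m + i) * B + B"
      by auto
    have "Suc i * B \<le> m * B" using i(2) by (intro mult_right_mono) auto
    then have lt: "n < j * (B * m) + B * m"
      using i(5) by (simp add: algebra_simps)
    have "2 * B \<le> i * B" using i(1) by (intro mult_right_mono) auto
    then have ge: "j * (B * m) + 2 * B \<le> n"
      using i(4) by (simp only: distrib_right mult.assoc mult.commute[of m B])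
    define d where "d = n - j * (B * m)"
    have d: "n = j * (B * m) + d" "2 * B \<le> d" "d < B * m"
      using ge lt unfolding d_def by linarith+
    have "n mod (B * m) = d" using d by simp
    then have "2 * B \<le> n mod (B * m)" using d by simp
    then show "n \<in> G p (Suc s) \<inter> ?W"
      using i(3) ge lt m B_def by (auto simp: G_def le_Suc_eq)
  qed
  have disj: "?V i \<inter> ?V i' = {}" if "i \<noteq> i'" for i i'
  proof -
    have *: "?V i \<inter> ?V i' = {}" if "i < i'" for i i'
    proof -
      have "(j * m + Suc i) * B \<le> (j * m + i') * B" using that by (intro mult_right_mono) auto
      then show ?thesis by (auto simp: algebra_simps)
    qed
    show ?thesis using *[of i i'] *[of i' i] that by (metis Int_commute linorder_neqE_nat)
  qed
  have "(real m - 2) * (B / L (Suc p) * (1 - \<sigma>)) = (\<Sum>i\<in>{2..<m}. real B / L (Suc p) * (1 - \<sigma>))"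
    using m2 by simp
  also have "\<dots> \<le> (\<Sum>i\<in>{2..<m}. real (card (?V i)))"
    using step.IH unfolding \<sigma>_def B_def by (intro sum_mono) auto
  also have "\<dots> = real (card (\<Union>i\<in>{2..<m}. ?V i))"
    using disj by (subst card_UN_disjoint) auto
  also have "\<dots> \<le> real (card (G p (Suc s) \<inter> ?W))"
    using sub by (intro of_nat_mono card_mono) auto
  finally have main: "(real m - 2) * (B / L (Suc p) * (1 - \<sigma>)) \<le> card (G p (Suc s) \<inter> ?W)" .
  have \<sigma>0: "0 \<le> \<sigma>" unfolding \<sigma>_def by (intro sum_nonneg) auto
  have "{p<..Suc s} = insert (Suc s) {p<..s}" using step.hyps by auto
  then have "(\<Sum>r\<in>{p<..Suc s}. 2 * L r / L (Suc r)) = 2 / real m + \<sigma>"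
    using B m2 by (simp add: \<sigma>_def m B_def[symmetric])
  moreover have "real (B * m) / L (Suc p) * (1 - (2 / real m + \<sigma>))
      \<le> (real m - 2) * (B / L (Suc p) * (1 - \<sigma>))"
  proof -
    have "real m * (1 - (2 / real m + \<sigma>)) \<le> (real m - 2) * (1 - \<sigma>)"
      using m2 \<sigma>0 by (simp add: algebra_simps)
    then have "real B / L (Suc p) * (real m * (1 - (2 / real m + \<sigma>)))
        \<le> real B / L (Suc p) * ((real m - 2) * (1 - \<sigma>))"
      by (intro mult_left_mono) auto
    moreover have "real (B * m) / L (Suc p) * (1 - (2 / real m + \<sigma>))
        = real B / L (Suc p) * (real m * (1 - (2 / real m + \<sigma>)))"
      by simp
    ultimately show ?thesis by (simp only: mult.left_commute)
  qed
  ultimately show ?case using main unfolding m by simp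
qed

lemma card_G_block:
  assumes "p \<le> s"
  shows "real (L (Suc s)) \<le> 2 * L (Suc p) *
    card (G p s \<inter> {j * L (Suc s)..<j * L (Suc s) + L (Suc s)})"
proof -
  have "(\<Sum>r\<in>{p<..s}. 2 * L r / L (Suc r)) \<le> (\<Sum>r\<in>{p<..s}. (1 / 2) ^ Suc r :: real)"
  proof (intro sum_mono)
    fix r
    have "real (2 ^ (r + 2) * L r) \<le> real (L (Suc r))"
      using L_growth[of r] of_nat_mono by blast
    then show "2 * L r / L (Suc r) \<le> (1 / 2 :: real) ^ Suc r"
      using L_pos[of "Suc r"] by (simp add: field_simps)
  qed
  also have "\<dots> \<le> (\<Sum>r\<in>{1..s}. (1 / 2) ^ Suc r)"
    by (intro sum_mono2) auto
  also have "\<dots> \<le> 1 / 2"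
  proof -
    have "(\<Sum>r\<in>{1..s}. (1 / 2) ^ Suc r) = 1 / 2 - (1 / 2 :: real) ^ Suc s"
      by (induction s) auto
    then show ?thesis by simp
  qed
  finally have "real (L (Suc s)) / L (Suc p) * (1 / 2)
      \<le> real (L (Suc s)) / L (Suc p) * (1 - (\<Sum>r\<in>{p<..s}. 2 * L r / L (Suc r)))"
    by (intro mult_left_mono) auto
  also note card_G_block_aux[OF assms, of j]
  finally show ?thesis using L_pos[of "Suc p"] by (simp add: field_simps)
qed

lemma E_eq_G:
  assumes "p \<le> s" "T s \<le> n" "n < T (Suc s)"
  shows "n \<in> E p \<longleftrightarrow> n \<in> G p s"
proof -
  have "T p \<le> T s" using assms(1) T_mono by (simp add: strict_mono_less_eq)
  moreover have "T r \<le> n \<longleftrightarrow> r \<le> s" for r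
  proof
    assume "T r \<le> n"
    then have "T r < T (Suc s)" using assms by linarith
    then show "r \<le> s" using T_mono by (simp add: strict_mono_less)
  next
    assume "r \<le> s"
    then have "T r \<le> T s" using T_mono by (simp add: strict_mono_less_eq)
    then show "T r \<le> n" using assms by linarith
  qed
  ultimately show ?thesis using assms by (auto simp: E_def G_def)
qed

text \<open>
  From now on the thresholds are so large that \<open>\<alpha>\<close> varies by a factor at most 2 over a distance
  \<open>L (Suc s)\<close>, already from one block before \<open>T s\<close>. The extra block is needed to compare an
  incomplete block that starts at \<open>T s\<close> with the block preceding it.
\<close>

context
  fixes \<alpha> :: "nat \<Rightarrow> real"
  assumes \<alpha>_pos: "\<And>k. 0 < \<alpha> k"
    and comparable: "\<And>s k i. T s \<le> k + L (Suc s) \<Longrightarrow> i \<le> L (Suc s) \<Longrightarrow>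
       \<alpha> (k + i) \<le> 2 * \<alpha> k \<and> \<alpha> k \<le> 2 * \<alpha> (k + i)"
begin

lemma sum_block_le:
  assumes "p \<le> s" "T s \<le> a" "L (Suc s) dvd a" "a + L (Suc s) \<le> T (Suc s)"
  shows "(\<Sum>k\<in>{a..<a + L (Suc s)}. \<alpha> k)
    \<le> 8 * L (Suc p) * (\<Sum>k\<in>E p \<inter> {a..<a + L (Suc s)}. \<alpha> k)"
proof -
  define I where "I = {a..<a + L (Suc s)}"
  obtain j where j: "a = j * L (Suc s)" using assms(3) by (metis dvdE mult.commute)
  have I: "\<alpha> k \<le> 2 * \<alpha> a \<and> \<alpha> a \<le> 2 * \<alpha> k" if "k \<in> I" for k
    using comparable[of s a "k - a"] that assms(2) by (auto simp: I_def)
  have EG: "E p \<inter> I = G p s \<inter> I"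
    using E_eq_G[OF assms(1)] assms(2,4) by (auto simp: I_def)
  have "(\<Sum>k\<in>I. \<alpha> k) \<le> (\<Sum>k\<in>I. 2 * \<alpha> a)"
    using I by (intro sum_mono) auto
  also have "\<dots> = real (L (Suc s)) * (2 * \<alpha> a)" by (simp add: I_def)
  also have "\<dots> \<le> (2 * L (Suc p) * card (G p s \<inter> I)) * (2 * \<alpha> a)"
    using card_G_block[OF assms(1), of j] \<alpha>_pos[of a]
    by (intro mult_right_mono) (auto simp: I_def j)
  also have "\<dots> = 8 * L (Suc p) * (\<Sum>k\<in>G p s \<inter> I. \<alpha> a / 2)"
    by simp
  also have "\<dots> \<le> 8 * L (Suc p) * (\<Sum>k\<in>G p s \<inter> I. \<alpha> k)"
    using I by (intro mult_left_mono sum_mono) (auto simp: mult.commute)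
  finally show ?thesis unfolding EG[symmetric] by (simp only: I_def)
qed

lemma sum_append_le:
  fixes K :: real
  assumes "a \<le> b" "b \<le> c"
    and "(\<Sum>k\<in>{a..<b}. \<alpha> k) \<le> K * (\<Sum>k\<in>E p \<inter> {a..<b}. \<alpha> k)"
    and "(\<Sum>k\<in>{b..<c}. \<alpha> k) \<le> K * (\<Sum>k\<in>E p \<inter> {b..<c}. \<alpha> k)"
  shows "(\<Sum>k\<in>{a..<c}. \<alpha> k) \<le> K * (\<Sum>k\<in>E p \<inter> {a..<c}. \<alpha> k)"
proof -
  have "(\<Sum>k\<in>{a..<c}. \<alpha> k) = (\<Sum>k\<in>{a..<b}. \<alpha> k) + (\<Sum>k\<in>{b..<c}. \<alpha> k)"
    using assms(1,2) by (simp add: sum.atLeastLessThan_concat)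
  moreover have "E p \<inter> {a..<c} = (E p \<inter> {a..<b}) \<union> (E p \<inter> {b..<c})"
    using assms(1,2) by auto
  then have "(\<Sum>k\<in>E p \<inter> {a..<c}. \<alpha> k)
      = (\<Sum>k\<in>E p \<inter> {a..<b}. \<alpha> k) + (\<Sum>k\<in>E p \<inter> {b..<c}. \<alpha> k)"
    by (simp only:) (rule sum.union_disjoint; auto)
  ultimately show ?thesis using assms(3,4) by (simp add: distrib_left)
qed

text \<open>
  The bound for a single block passes to unions of consecutive blocks: within one scale by adding
  block after block, and from one scale to the next because \<open>T (Suc s) - T s\<close> is a multiple of
  \<open>L (Suc s)\<close>.
\<close>

lemma sum_blocks_append_le:
  assumes "p \<le> s" "T s + j * L (Suc s) \<le> T (Suc s)"
    and "(\<Sum>k\<in>{T p..<T s}. \<alpha> k) \<le> 8 * L (Suc p) * (\<Sum>k\<in>E p \<inter> {T p..<T s}. \<alpha> k)"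
  shows "(\<Sum>k\<in>{T p..<T s + j * L (Suc s)}. \<alpha> k)
    \<le> 8 * L (Suc p) * (\<Sum>k\<in>E p \<inter> {T p..<T s + j * L (Suc s)}. \<alpha> k)"
  using assms(2)
proof (induction j)
  case 0
  then show ?case using assms(3) by simp
next
  case (Suc j)
  define a where "a = T s + j * L (Suc s)"
  have a: "T s + Suc j * L (Suc s) = a + L (Suc s)" by (simp add: a_def)
  have 1: "T p \<le> T s" using assms(1) T_mono by (simp add: strict_mono_less_eq)
  have 2: "(\<Sum>k\<in>{a..<a + L (Suc s)}. \<alpha> k)
      \<le> 8 * L (Suc p) * (\<Sum>k\<in>E p \<inter> {a..<a + L (Suc s)}. \<alpha> k)"
    using Suc.prems T_dvd[of s] assms(1) unfolding a
    by (intro sum_block_le) (auto simp: a_def)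
  have 3: "(\<Sum>k\<in>{T p..<a}. \<alpha> k) \<le> 8 * L (Suc p) * (\<Sum>k\<in>E p \<inter> {T p..<a}. \<alpha> k)"
    unfolding a_def using Suc.prems by (intro Suc.IH) simp
  have 4: "T s \<le> a" by (simp add: a_def)
  show ?case
    unfolding a by (rule sum_append_le[OF le_trans[OF 1 4] _ 3 2]) simp
qed

lemma sum_to_threshold_le:
  assumes "p \<le> s"
  shows "(\<Sum>k\<in>{T p..<T s}. \<alpha> k) \<le> 8 * L (Suc p) * (\<Sum>k\<in>E p \<inter> {T p..<T s}. \<alpha> k)"
  using assms
proof (induction s rule: dec_induct)
  case base
  then show ?case by simp
next
  case (step s)
  have "L (Suc s) dvd T (Suc s)"
    using L_dvd T_dvd dvd_trans by blast
  then have "L (Suc s) dvd T (Suc s) - T s"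
    using T_dvd[of s] by (rule dvd_diff_nat)
  then obtain j where "T (Suc s) - T s = j * L (Suc s)"
    by (metis dvdE mult.commute)
  moreover have "T s < T (Suc s)" using T_mono by (simp add: strict_mono_less)
  ultimately have "T (Suc s) = T s + j * L (Suc s)" by linarith
  then show ?case
    using sum_blocks_append_le[OF step.hyps(1) _ step.IH, of j] by simp
qed

lemma sum_le_E:
  assumes "T p \<le> n"
  shows "(\<Sum>k\<le>n. \<alpha> k)
    \<le> 3 * ((\<Sum>k<T p. \<alpha> k) + 8 * L (Suc p) * (\<Sum>k\<in>E p \<inter> {..n}. \<alpha> k))"
proof -
  have ex: "\<exists>m. n < T m"
    using T_mono by (metis lessI order_less_le_trans strict_mono_imp_increasing)
  define m where "m = (LEAST m. n < T m)"
  have m: "n < T m" unfolding m_def using ex by (rule LeastI_ex)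
  have "p < m"
    using m assms T_mono by (metis linorder_not_less order_less_le_trans strict_mono_less_eq)
  then obtain s where s: "m = Suc s" "p \<le> s" by (metis less_Suc_eq_le gr0_implies_Suc less_nat_zero_code not_gr_zero)
  have Ts: "T s \<le> n"
    using not_less_Least[of s "\<lambda>m. n < T m"] s(1) unfolding m_def by linarith
  define B where "B = L (Suc s)"
  have B: "0 < B" using L_pos B_def by simp
  define j where "j = (n - T s) div B"
  \<comment> \<open>the left end of the block that contains \<open>n\<close>\<close>
  define b where "b = T s + j * B"
  have "j * B \<le> n - T s" "n - T s < j * B + B"
    using B div_times_less_eq_dividend[of "n - T s" B] dividend_less_div_times[of B "n - T s"]
    unfolding j_def by (auto simp: mult.commute)
  then have b: "b \<le> n" "n < b + B" using Ts unfolding b_def by linarith+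
  have TpTs: "T p \<le> T s" using s(2) T_mono by (simp add: strict_mono_less_eq)
  have TB: "B \<le> T s"
    unfolding B_def by (rule T_ge)
  have "(\<Sum>k\<in>{T p..<b}. \<alpha> k) \<le> 8 * L (Suc p) * (\<Sum>k\<in>E p \<inter> {T p..<b}. \<alpha> k)"
    using b m s unfolding b_def B_def
    by (intro sum_blocks_append_le sum_to_threshold_le) auto
  also have "\<dots> \<le> 8 * L (Suc p) * (\<Sum>k\<in>E p \<inter> {..n}. \<alpha> k)"
    using b \<alpha>_pos by (intro mult_left_mono sum_mono2) (auto intro: less_imp_le)
  finally have main: "(\<Sum>k\<in>{T p..<b}. \<alpha> k) \<le> 8 * L (Suc p) * (\<Sum>k\<in>E p \<inter> {..n}. \<alpha> k)" .
  have split: "(\<Sum>k<b. \<alpha> k) = (\<Sum>k<T p. \<alpha> k) + (\<Sum>k\<in>{T p..<b}. \<alpha> k)"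
    using TpTs by (simp add: b_def lessThan_atLeast0 sum.atLeastLessThan_concat)
  \<comment> \<open>the block containing \<open>n\<close> weighs at most twice as much as the interval of the same length before it\<close>
  have "(\<Sum>k\<in>{b..<b + B}. \<alpha> k) = (\<Sum>k\<in>{b - B..<b}. \<alpha> (k + B))"
    using TB sum.shift_bounds_nat_ivl[of \<alpha> "b - B" B b] by (simp add: b_def)
  also have "\<dots> \<le> (\<Sum>k\<in>{b - B..<b}. 2 * \<alpha> k)"
    using comparable[of s _ B] by (intro sum_mono) (auto simp: B_def b_def)
  also have "\<dots> = 2 * (\<Sum>k\<in>{b - B..<b}. \<alpha> k)"
    by (simp add: sum_distrib_left)
  also have "\<dots> \<le> 2 * (\<Sum>k<b. \<alpha> k)"
    using \<alpha>_pos by (intro mult_left_mono sum_mono2) (auto intro: less_imp_le)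
  finally have "(\<Sum>k\<in>{b..<b + B}. \<alpha> k) \<le> 2 * (\<Sum>k<b. \<alpha> k)" .
  moreover have "(\<Sum>k\<le>n. \<alpha> k) \<le> (\<Sum>k<b + B. \<alpha> k)"
    using b \<alpha>_pos by (intro sum_mono2) (auto intro: less_imp_le)
  moreover have "(\<Sum>k<b + B. \<alpha> k) = (\<Sum>k<b. \<alpha> k) + (\<Sum>k\<in>{b..<b + B}. \<alpha> k)"
    by (simp add: lessThan_atLeast0 sum.atLeastLessThan_concat)
  ultimately show ?thesis using main split by simp
qed

lemma lower_density_E_pos:
  assumes div: "filterlim (\<lambda>n. \<Sum>k=1..n. \<alpha> k) at_top sequentially"
  shows "0 < lower_density (admissible_matrix \<alpha>) (E p)"
proof -
  define C where "C = (\<Sum>k<T p. \<alpha> k)"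
  define K where "K = real (8 * L (Suc p))"
  have K: "0 < K" using L_pos by (simp add: K_def)
  have "\<forall>\<^sub>F n in sequentially. 1 \<le> (\<Sum>k=1..n. \<alpha> k)"
    "\<forall>\<^sub>F n in sequentially. 6 * C \<le> (\<Sum>k=1..n. \<alpha> k)"
    using div unfolding filterlim_at_top by blast+
  with eventually_ge_at_top[of "T p"]
  have "\<forall>\<^sub>F n in sequentially.
      ereal (1 / (6 * K)) \<le> ereal ((\<Sum>k\<in>E p \<inter> {1..n}. \<alpha> k) / (\<Sum>j=1..n. \<alpha> j))"
  proof eventually_elim
    case (elim n)
    define A where "A = (\<Sum>k=1..n. \<alpha> k)"
    have "A \<le> (\<Sum>k\<le>n. \<alpha> k)"
      unfolding A_def using \<alpha>_pos by (intro sum_mono2) (auto intro: less_imp_le)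
    also have "\<dots> \<le> 3 * (C + K * (\<Sum>k\<in>E p \<inter> {..n}. \<alpha> k))"
      using sum_le_E[OF elim(1)] by (simp add: C_def K_def)
    also have "E p \<inter> {..n} = E p \<inter> {1..n}"
      using le_L_of_E[of _ p] L_pos[of p] by (force simp: Suc_le_eq)
    finally have "A \<le> 6 * K * (\<Sum>k\<in>E p \<inter> {1..n}. \<alpha> k)"
      using elim(3) unfolding A_def[symmetric] by (simp add: algebra_simps)
    then show ?case
      using elim(2) K unfolding A_def[symmetric] by (simp add: field_simps)
  qed
  then have "ereal (1 / (6 * K)) \<le> lower_density (admissible_matrix \<alpha>) (E p)"
    unfolding lower_density_admissible_matrix by (rule Liminf_bounded)
  moreover have "0 < ereal (1 / (6 * K))" using K by simp
  ultimately show ?thesis by (rule less_le_trans[rotated])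
qed

end

end

lemma separated_sets_of_positive_lower_density:
  fixes \<alpha> :: "nat \<Rightarrow> real" and N :: "nat \<Rightarrow> nat"
  assumes pos: "\<And>k. 0 < \<alpha> k"
    and ratio: "(\<lambda>k. \<alpha> (Suc k) / \<alpha> k) \<longlonglongrightarrow> 1"
    and div: "filterlim (\<lambda>n. \<Sum>k=1..n. \<alpha> k) at_top sequentially"
  obtains E where
    "\<And>p n. n \<in> E p \<Longrightarrow> N p \<le> n"
    "\<And>p q n. n \<in> E p \<Longrightarrow> n \<in> E q \<Longrightarrow> p = q"
    "\<And>p q n m. n \<in> E p \<Longrightarrow> m \<in> E q \<Longrightarrow> n < m \<Longrightarrow> N p \<le> m - n \<and> N q \<le> m - n"
    "\<And>p. 0 < lower_density (admissible_matrix \<alpha>) (E p)"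
proof -
  \<comment> \<open>a divisibility chain that grows by factors at least \<open>2 ^ (r + 2)\<close> and dominates \<open>N\<close>\<close>
  define L where "L r = (\<Prod>i\<le>r. 2 ^ (i + 1) * Suc (N i))" for r
  have Suc_L: "L (Suc r) = 2 ^ (r + 2) * L r * Suc (N (Suc r))" for r
    by (simp add: L_def algebra_simps)
  have L_pos: "0 < L r" for r by (simp add: L_def)
  have L_dvd: "L r dvd L (Suc r)" for r by (simp add: Suc_L)
  have N_le: "N r \<le> L r" for r
  proof (cases r)
    case 0
    then show ?thesis by (simp add: L_def)
  next
    case (Suc k)
    have "1 * Suc (N r) \<le> (2 ^ (k + 2) * L k) * Suc (N r)"
      using L_pos[of k] by (intro mult_right_mono) (auto simp: Suc_le_eq)
    then show ?thesis using Suc_L[of k] Suc by simp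
  qed
  have "\<exists>K. \<forall>k\<ge>K. \<forall>i\<in>{..L (Suc s)}. \<alpha> (k + i) \<le> 2 * \<alpha> k \<and> \<alpha> k \<le> 2 * \<alpha> (k + i)" for s
    using eventually_comparable[OF pos ratio] unfolding eventually_sequentially by blast
  then obtain \<tau> where \<tau>: "\<And>s k i. \<tau> s \<le> k \<Longrightarrow> i \<le> L (Suc s) \<Longrightarrow>
      \<alpha> (k + i) \<le> 2 * \<alpha> k \<and> \<alpha> k \<le> 2 * \<alpha> (k + i)"
    by (metis atMost_iff)
  \<comment> \<open>the partial sums make \<open>T\<close> increasing, and the summand 2 leaves one block of room below \<open>T s\<close>\<close>
  define T where "T s = L (Suc s) * (\<Sum>i\<le>s. \<tau> i + 2)" for s
  have \<tau>_le: "\<tau> s + L (Suc s) \<le> T s" for s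
  proof -
    have "\<tau> s + 1 * L (Suc s) \<le> L (Suc s) * (\<tau> s + 2)"
      using L_pos[of "Suc s"] by (cases "L (Suc s)") auto
    also have "\<dots> \<le> T s"
      unfolding T_def by (intro mult_left_mono member_le_sum) auto
    finally show ?thesis by simp
  qed
  interpret block_scales L T
  proof
    show "0 < L r" for r by (rule L_pos)
    show "L r dvd L (Suc r)" for r by (rule L_dvd)
    show "2 ^ (r + 2) * L r \<le> L (Suc r)" for r by (simp add: Suc_L)
    show "L (Suc s) dvd T s" for s by (simp add: T_def)
    show "L (Suc s) \<le> T s" for s using \<tau>_le[of s] by simp
    show "strict_mono T"
      unfolding strict_mono_Suc_iff
    proof
      fix s
      have "L (Suc s) * (\<Sum>i\<le>s. \<tau> i + 2) < L (Suc s) * (\<Sum>i\<le>Suc s. \<tau> i + 2)"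
        using L_pos[of "Suc s"] by (intro mult_strict_left_mono) auto
      also have "\<dots> \<le> L (Suc (Suc s)) * (\<Sum>i\<le>Suc s. \<tau> i + 2)"
          using dvd_imp_le[OF L_dvd L_pos] by (intro mult_right_mono) auto
      finally show "T s < T (Suc s)" by (simp add: T_def)
    qed
  qed
  show ?thesis
  proof (rule that[of E])
    show "N p \<le> n" if "n \<in> E p" for p n
      using N_le[of p] le_L_of_E[OF that] by simp
    show "p = q" if "n \<in> E p" "n \<in> E q" for p q n
      using that by (rule E_disjoint)
    show "N p \<le> m - n \<and> N q \<le> m - n" if "n \<in> E p" "m \<in> E q" "n < m" for p q n m
    proof -
      have "N p \<le> L (max p q)" "N q \<le> L (max p q)"
        using N_le L_mono by (meson le_trans max.cobounded1 max.cobounded2 monoD)+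
      then show ?thesis using le_L_diff[OF that(3,1,2)] by simp
    qed
    show "0 < lower_density (admissible_matrix \<alpha>) (E p)" for p
    proof (rule lower_density_E_pos[OF pos _ div])
      fix s k i assume "T s \<le> k + L (Suc s)" "i \<le> L (Suc s)"
      then show "\<alpha> (k + i) \<le> 2 * \<alpha> k \<and> \<alpha> k \<le> 2 * \<alpha> (k + i)"
        using \<tau>_le[of s] by (intro \<tau>) auto
    qed
  qed
qed

lemma lower_density_admissible_mono:
  assumes "\<And>k. 0 \<le> \<alpha> k" "A \<subseteq> B"
  shows "lower_density (admissible_matrix \<alpha>) A \<le> lower_density (admissible_matrix \<alpha>) B"
  unfolding lower_density_admissible_matrix
  using assms
  by (intro Liminf_mono always_eventually allI)
    (auto intro!: divide_right_mono sum_mono2 sum_nonneg)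


section \<open>Groups with an increasing sequence of seminorms\<close>

text \<open>
  The part of the structure of a Frechet space that the criterion uses: an abelian group whose
  topology is given by an increasing sequence of group seminorms \<open>P i\<close> (no scalars), and which is
  sequentially complete. As the sequence is increasing, balls for a single seminorm suffice in
  the description of the open sets. The Hausdorff property is not required.
\<close>

locale graded_seminormed_group =
  fixes P :: "nat \<Rightarrow> 'a::{ab_group_add,topological_space} \<Rightarrow> real"
  assumes P_zero: "P i 0 = 0"
    and P_triangle: "P i (x + y) \<le> P i x + P i y"
    and P_minus: "P i (- x) = P i x"
    and P_mono: "i \<le> j \<Longrightarrow> P i x \<le> P j x"
    and open_iff: "open U \<longleftrightarrow> (\<forall>x\<in>U. \<exists>n. \<exists>e>0. \<forall>y. P n (y - x) < e \<longrightarrow> y \<in> U)"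
    and complete: "(\<And>i e. 0 < e \<Longrightarrow> \<exists>M. \<forall>m\<ge>M. \<forall>n\<ge>M. P i (u m - u n) < e) \<Longrightarrow> \<exists>l. u \<longlonglongrightarrow> l"
begin

lemma P_minus_commute: "P i (x - y) = P i (y - x)"
  using P_minus[of i "x - y"] by simp

lemma P_triangle3: "P i (x - z) \<le> P i (x - y) + P i (y - z)"
  using P_triangle[of i "x - y" "y - z"] by simp

lemma P_sum_le: "P i (sum f A) \<le> (\<Sum>a\<in>A. P i (f a))"
proof (induction A rule: infinite_finite_induct)
  case (insert a A)
  then show ?case using P_triangle[of i "f a" "sum f A"] by simp
qed (simp_all add: P_zero)

lemma open_P_ball: "open {y. P i (y - x) < e}"
  unfolding open_iff
proof safe
  fix y assume y: "P i (y - x) < e"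
  have "P i (z - x) < e" if "P i (z - y) < e - P i (y - x)" for z
    using P_triangle3[of i z x y] that by linarith
  then show "\<exists>n. \<exists>e'>0. \<forall>z. P n (z - y) < e' \<longrightarrow> z \<in> {y. P i (y - x) < e}"
    using y by (intro exI[of _ i] exI[of _ "e - P i (y - x)"]) auto
qed

lemma eventually_P_less:
  assumes "(f \<longlongrightarrow> l) F" "0 < e"
  shows "\<forall>\<^sub>F a in F. P i (f a - l) < e"
  using topological_tendstoD[OF assms(1) open_P_ball[of i l e]] assms(2) by (simp add: P_zero)

text \<open>
  Cauchy criterion for unconditional convergence: all finite partial sums over indices far from
  the origin are small, whatever the set of indices is.
\<close>

lemma summable_on_small_tails:
  fixes f :: "nat \<Rightarrow> 'a"
  assumes "f summable_on UNIV" "0 < e"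
  shows "\<exists>N. \<forall>F. finite F \<and> F \<subseteq> {N..} \<longrightarrow> P i (sum f F) < e"
proof -
  obtain l where "(f has_sum l) UNIV"
    using assms(1) by (auto simp: summable_on_def)
  then have "(sum f \<longlongrightarrow> l) (finite_subsets_at_top UNIV)"
    by (simp add: has_sum_def)
  then have "\<forall>\<^sub>F Y in finite_subsets_at_top UNIV. P i (sum f Y - l) < e / 2"
    using assms(2) by (intro eventually_P_less) auto
  then obtain X where X: "finite X" "\<And>Y. finite Y \<Longrightarrow> X \<subseteq> Y \<Longrightarrow> P i (sum f Y - l) < e / 2"
    unfolding eventually_finite_subsets_at_top by auto
  obtain N where N: "X \<subseteq> {..<N}"
    using X(1) finite_nat_bounded by blast
  have "P i (sum f F) < e" if "finite F" "F \<subseteq> {N..}" for F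
  proof -
    have "X \<inter> F = {}" using N that(2) by fastforce
    then have "sum f F = sum f (X \<union> F) - sum f X"
      using X(1) that(1) by (simp add: sum.union_disjoint)
    then have "P i (sum f F) \<le> P i (sum f (X \<union> F) - l) + P i (sum f X - l)"
      using P_triangle3[of i "sum f (X \<union> F)" "sum f X" l] P_minus_commute[of i l] by simp
    also have "\<dots> < e"
      using X(2)[of "X \<union> F"] X(2)[of X] X(1) that(1) by simp
    finally show ?thesis .
  qed
  then show ?thesis by blast
qed

end

lemma (in frechet_space) graded_seminormed_group:
  obtains P where "graded_seminormed_group (P :: nat \<Rightarrow> 'a \<Rightarrow> real)"
proof -
  obtain p :: "nat \<Rightarrow> 'a \<Rightarrow> real" where sn: "\<forall>i. seminorm scl (p i)"
    and op: "\<forall>U. open U \<longleftrightarrow> (\<forall>x\<in>U. \<exists>n. \<exists>e>0. \<forall>y. (\<forall>i\<le>n. p i (y - x) < e) \<longrightarrow> y \<in> U)"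
    and "\<forall>x. (\<forall>i. p i x = 0) \<longrightarrow> x = 0"
    and compl: "\<forall>u :: nat \<Rightarrow> 'a.
       (\<forall>i. \<forall>e>0. \<exists>N. \<forall>m\<ge>N. \<forall>n\<ge>N. p i (u m - u n) < e) \<longrightarrow> (\<exists>l. u \<longlonglongrightarrow> l)"
    using seminorms by (elim exE conjE) (rule that)
  have nonneg: "0 \<le> p i x" and tri: "p i (x + y) \<le> p i x + p i y"
    and scale: "p i (scl c x) = norm c * p i x" for i x y c
    using sn[rule_format, of i] by (auto simp: seminorm_def)
  have zero: "p i 0 = 0" for i
    using scale[of i 0 0] by simp
  have minus: "p i (- x) = p i x" for i x
    using scale[of i "-1" x] by simp
  define P where "P n x = (\<Sum>i\<le>n. p i x)" for n x
  have p_le_P: "p i x \<le> P n x" if "i \<le> n" for i n x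
    unfolding P_def using that nonneg by (intro member_le_sum) auto
  have P_less: "P n x < e" if "\<And>i. i \<le> n \<Longrightarrow> p i x < e / Suc n" for n x e
  proof -
    have "P n x < (\<Sum>i\<le>n. e / Suc n)"
      unfolding P_def using that by (intro sum_strict_mono) auto
    then show ?thesis by simp
  qed
  have "graded_seminormed_group P"
  proof
    show "P i 0 = 0" for i by (simp add: P_def zero)
    show "P i (x + y) \<le> P i x + P i y" for i x y
      unfolding P_def using tri by (simp add: sum_mono flip: sum.distrib)
    show "P i (- x) = P i x" for i x by (simp add: P_def minus)
    show "P i x \<le> P j x" if "i \<le> j" for i j x
      unfolding P_def using that nonneg by (intro sum_mono2) auto
    show "open U \<longleftrightarrow> (\<forall>x\<in>U. \<exists>n. \<exists>e>0. \<forall>y. P n (y - x) < e \<longrightarrow> y \<in> U)" for U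
    proof -
      have "(\<exists>e>0. \<forall>y. (\<forall>i\<le>n. p i (y - x) < e) \<longrightarrow> y \<in> U)
          \<longleftrightarrow> (\<exists>e>0. \<forall>y. P n (y - x) < e \<longrightarrow> y \<in> U)" for n x
      proof
        assume "\<exists>e>0. \<forall>y. (\<forall>i\<le>n. p i (y - x) < e) \<longrightarrow> y \<in> U"
        then show "\<exists>e>0. \<forall>y. P n (y - x) < e \<longrightarrow> y \<in> U"
          using p_le_P by (meson le_less_trans)
      next
        assume "\<exists>e>0. \<forall>y. P n (y - x) < e \<longrightarrow> y \<in> U"
        then obtain e where "e > 0" "\<And>y. P n (y - x) < e \<Longrightarrow> y \<in> U" by blast
        then show "\<exists>e>0. \<forall>y. (\<forall>i\<le>n. p i (y - x) < e) \<longrightarrow> y \<in> U"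
          using P_less by (intro exI[of _ "e / Suc n"]) auto
      qed
      then show ?thesis by (simp add: op)
    qed
    show "\<exists>l. u \<longlonglongrightarrow> l"
      if "\<And>i e. 0 < e \<Longrightarrow> \<exists>M. \<forall>m\<ge>M. \<forall>n\<ge>M. P i (u m - u n) < e" for u
      using that compl[rule_format, of u] p_le_P by (meson le_less_trans order_refl)
  qed
  then show ?thesis by (rule that)
qed


section \<open>Frequent hypercyclicity criterion\<close>

lemma funpow_right_inverse:
  assumes "S \<in> X0 \<rightarrow> X0" "\<And>x. x \<in> X0 \<Longrightarrow> T (S x) = x" "x \<in> X0"
  shows "m \<le> n \<Longrightarrow> (T ^^ n) ((S ^^ m) x) = (T ^^ (n - m)) x"
    and "n \<le> m \<Longrightarrow> (T ^^ n) ((S ^^ m) x) = (S ^^ (m - n)) x"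
proof -
  have mem: "(S ^^ m) x \<in> X0" for m
    using assms by (induction m) auto
  have cancel: "(T ^^ k) ((S ^^ (k + l)) x) = (S ^^ l) x" for k l
    using assms(2)[OF mem] by (induction k arbitrary: l) (simp_all add: funpow_swap1)
  show "(T ^^ n) ((S ^^ m) x) = (T ^^ (n - m)) x" if "m \<le> n"
    using that cancel[of m 0] funpow_add[of "n - m" m T] by simp
  show "(T ^^ n) ((S ^^ m) x) = (S ^^ (m - n)) x" if "n \<le> m"
    using that cancel[of n "m - n"] by simp
qed

context graded_seminormed_group
begin

lemma sum_half_power_le: "(\<Sum>q<K. (1 / 2 :: real) ^ (max q Q + q)) \<le> 2 * (1 / 2) ^ Q"
proof -
  have "(\<Sum>q<K. (1 / 2 :: real) ^ (max q Q + q)) \<le> (\<Sum>q<K. (1 / 2) ^ Q * (1 / 2) ^ q)"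
    by (intro sum_mono) (auto simp: power_add intro!: mult_right_mono power_decreasing)
  also have "\<dots> = (1 / 2) ^ Q * (\<Sum>q<K. (1 / 2) ^ q)"
    by (simp add: sum_distrib_left)
  also have "\<dots> \<le> (1 / 2) ^ Q * 2"
    by (intro mult_left_mono) (simp_all add: sum_gp_strict)
  finally show ?thesis by simp
qed

text \<open>
  The vector \<open>x\<close> is the limit of the finite sums \<open>u K\<close> over the indices below \<open>K\<close>. All estimates
  come from the same observation: a piece of the series of \<open>y q\<close> whose indices are at least
  \<open>N (max q p)\<close> is at most \<open>(1 / 2) ^ (max q p + q)\<close> for the seminorm \<open>P (max q p)\<close>, hence also
  for \<open>P p\<close>, and the sum of these bounds over \<open>q\<close> is of order \<open>(1 / 2) ^ p\<close>.
\<close>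

lemma orbit_near_targets:
  fixes T S :: "'a \<Rightarrow> 'a" and y :: "nat \<Rightarrow> 'a" and N :: "nat \<Rightarrow> nat" and E :: "nat \<Rightarrow> nat set"
  assumes T_add: "\<And>x y. T (x + y) = T x + T y"
    and T_cont: "continuous_on UNIV T"
    and TS_le: "\<And>m n q. m \<le> n \<Longrightarrow> (T ^^ n) ((S ^^ m) (y q)) = (T ^^ (n - m)) (y q)"
    and TS_ge: "\<And>m n q. n \<le> m \<Longrightarrow> (T ^^ n) ((S ^^ m) (y q)) = (S ^^ (m - n)) (y q)"
    and N_gt: "\<And>r. r < N r"
    and T_tail: "\<And>r q F. q \<le> r \<Longrightarrow> finite F \<Longrightarrow> F \<subseteq> {N r..} \<Longrightarrow>
      P r (\<Sum>m\<in>F. (T ^^ m) (y q)) \<le> (1 / 2) ^ (r + q)"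
    and S_tail: "\<And>r q F. q \<le> r \<Longrightarrow> finite F \<Longrightarrow> F \<subseteq> {N r..} \<Longrightarrow>
      P r (\<Sum>m\<in>F. (S ^^ m) (y q)) \<le> (1 / 2) ^ (r + q)"
    and E_ge: "\<And>p n. n \<in> E p \<Longrightarrow> N p \<le> n"
    and E_disj: "\<And>p q n. n \<in> E p \<Longrightarrow> n \<in> E q \<Longrightarrow> p = q"
    and E_sep: "\<And>p q n m. n \<in> E p \<Longrightarrow> m \<in> E q \<Longrightarrow> n < m \<Longrightarrow> N p \<le> m - n \<and> N q \<le> m - n"
  shows "\<exists>x. \<forall>p. \<forall>n\<in>E p. P p ((T ^^ n) x - y p) \<le> 4 * (1 / 2) ^ p"
proof -
  have Tn_add: "(T ^^ n) (a + b) = (T ^^ n) a + (T ^^ n) b" for n a b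
    by (induction n) (simp_all add: T_add)
  have Tn_zero: "(T ^^ n) 0 = 0" for n
    using Tn_add[of n 0 0] by simp
  have Tn_sum: "(T ^^ n) (sum f A) = (\<Sum>a\<in>A. (T ^^ n) (f a))" for n A and f :: "nat \<Rightarrow> 'a"
    by (induction A rule: infinite_finite_induct) (simp_all add: Tn_zero Tn_add)
  have Tn_cont: "continuous_on UNIV (T ^^ n)" for n
  proof (induction n)
    case (Suc n)
    then show ?case
      using continuous_on_compose[OF Suc, of T] T_cont continuous_on_subset by auto
  qed (simp add: continuous_on_id id_def)
  define u where "u K = (\<Sum>q<K. \<Sum>m\<in>E q \<inter> {..<K}. (S ^^ m) (y q))" for K
  have diff: "P i (u K' - u K) \<le> 2 * (1 / 2) ^ Q"
    if "i \<le> Q" "N Q \<le> K" "K \<le> K'" for i Q K K'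
  proof -
    \<comment> \<open>since \<open>q < N q\<close>, sets with large index do not contribute, and both sums can be taken over \<open>q < K'\<close>\<close>
    have "E q \<inter> {..<K} = {}" if "K \<le> q" for q
      using that E_ge[of _ q] N_gt[of q] by fastforce
    then have "u K = (\<Sum>q<K'. \<Sum>m\<in>E q \<inter> {..<K}. (S ^^ m) (y q))"
      unfolding u_def using that(3) by (intro sum.mono_neutral_left) auto
    moreover have "(\<Sum>m\<in>E q \<inter> {..<K'}. (S ^^ m) (y q))
        = (\<Sum>m\<in>E q \<inter> {..<K}. (S ^^ m) (y q)) + (\<Sum>m\<in>E q \<inter> {K..<K'}. (S ^^ m) (y q))" for q
    proof -
      have *: "E q \<inter> {..<K'} = (E q \<inter> {..<K}) \<union> (E q \<inter> {K..<K'})"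
        using that(3) by auto
      show ?thesis unfolding * by (rule sum.union_disjoint) auto
    qed
    ultimately have "u K' - u K = (\<Sum>q<K'. \<Sum>m\<in>E q \<inter> {K..<K'}. (S ^^ m) (y q))"
      unfolding u_def[of K'] by (simp add: sum.distrib)
    then have "P i (u K' - u K) \<le> (\<Sum>q<K'. P i (\<Sum>m\<in>E q \<inter> {K..<K'}. (S ^^ m) (y q)))"
      by (simp add: P_sum_le)
    also have "\<dots> \<le> (\<Sum>q<K'. (1 / 2) ^ (max q Q + q))"
    proof (intro sum_mono)
      fix q
      have "P i (\<Sum>m\<in>E q \<inter> {K..<K'}. (S ^^ m) (y q))
          \<le> P (max q Q) (\<Sum>m\<in>E q \<inter> {K..<K'}. (S ^^ m) (y q))"
        using that(1) by (intro P_mono) auto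
      also have "\<dots> \<le> (1 / 2) ^ (max q Q + q)"
        using E_ge[of _ q] that(2) by (intro S_tail) (auto simp: max_def)
      finally show "P i (\<Sum>m\<in>E q \<inter> {K..<K'}. (S ^^ m) (y q)) \<le> (1 / 2) ^ (max q Q + q)" .
    qed
    also have "\<dots> \<le> 2 * (1 / 2) ^ Q" by (rule sum_half_power_le)
    finally show ?thesis .
  qed
  have "\<exists>x. u \<longlonglongrightarrow> x"
  proof (rule complete)
    fix i and e :: real assume e: "0 < e"
    have "(\<lambda>Q. 2 * (1 / 2 :: real) ^ Q) \<longlonglongrightarrow> 0" by real_asymp
    then have "\<forall>\<^sub>F Q in sequentially. 2 * (1 / 2 :: real) ^ Q < e"
      using e by (rule order_tendstoD)
    then obtain Q where Q: "i \<le> Q" "2 * (1 / 2 :: real) ^ Q < e"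
      using eventually_ge_at_top[of i] by (metis (mono_tags, lifting) eventually_conj eventually_happens' sequentially_bot)
    have "P i (u m - u n) < e" if "N Q \<le> m" "N Q \<le> n" for m n
      using diff[OF Q(1), of m n] diff[OF Q(1), of n m] that Q(2) P_minus_commute[of i "u m" "u n"]
      by (cases "m \<le> n") auto
    then show "\<exists>M. \<forall>m\<ge>M. \<forall>n\<ge>M. P i (u m - u n) < e" by blast
  qed
  then obtain x where x: "u \<longlonglongrightarrow> x" by blast
  have near: "P p ((T ^^ n) (u K) - y p) \<le> 4 * (1 / 2) ^ p"
    if n: "n \<in> E p" and K: "n < K" for p n K
  proof -
    \<comment> \<open>the contributions to \<open>(T ^^ n) (u K)\<close> of the indices below and above \<open>n\<close>\<close>
    define a where "a q = (\<Sum>m\<in>E q \<inter> {..<n}. (T ^^ (n - m)) (y q))" for q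
    define b where "b q = (\<Sum>m\<in>E q \<inter> {n<..<K}. (S ^^ (m - n)) (y q))" for q
    have pK: "p < K" using N_gt[of p] E_ge[OF n] K by linarith
    have "(\<Sum>m\<in>E q \<inter> {..<K}. (T ^^ n) ((S ^^ m) (y q))) = a q + b q + (if q = p then y p else 0)" for q
    proof -
      let ?f = "\<lambda>m. (T ^^ n) ((S ^^ m) (y q))"
      have *: "E q \<inter> {..<K} = ((E q \<inter> {..<n}) \<union> (E q \<inter> {n<..<K})) \<union> (E q \<inter> {n})"
        using K by auto
      have "sum ?f (E q \<inter> {..<K})
          = sum ?f ((E q \<inter> {..<n}) \<union> (E q \<inter> {n<..<K})) + sum ?f (E q \<inter> {n})"
        unfolding * by (rule sum.union_disjoint) auto
      also have "sum ?f ((E q \<inter> {..<n}) \<union> (E q \<inter> {n<..<K}))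
          = sum ?f (E q \<inter> {..<n}) + sum ?f (E q \<inter> {n<..<K})"
        by (rule sum.union_disjoint) auto
      finally have "sum ?f (E q \<inter> {..<K})
          = sum ?f (E q \<inter> {..<n}) + sum ?f (E q \<inter> {n<..<K}) + sum ?f (E q \<inter> {n})" .
      moreover have "E q \<inter> {n} = (if q = p then {n} else {})"
        using n E_disj by auto
      ultimately show ?thesis
        by (simp add: a_def b_def TS_le TS_ge)
    qed
    then have "(T ^^ n) (u K) = (\<Sum>q<K. a q + b q + (if q = p then y p else 0))"
      by (simp add: u_def Tn_sum)
    also have "\<dots> = (\<Sum>q<K. a q + b q) + y p"
      using pK by (simp add: sum.distrib)
    finally have "(T ^^ n) (u K) - y p = (\<Sum>q<K. a q + b q)" by simp
    then have "P p ((T ^^ n) (u K) - y p) \<le> (\<Sum>q<K. P p (a q + b q))"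
      by (simp add: P_sum_le)
    also have "\<dots> \<le> (\<Sum>q<K. 2 * (1 / 2) ^ (max q p + q))"
    proof (intro sum_mono)
      fix q
      have "a q = (\<Sum>k\<in>(\<lambda>m. n - m) ` (E q \<inter> {..<n}). (T ^^ k) (y q))"
        unfolding a_def by (subst sum.reindex) (auto intro!: inj_onI)
      moreover have "(\<lambda>m. n - m) ` (E q \<inter> {..<n}) \<subseteq> {N (max q p)..}"
        using E_sep[OF _ n, of _ q] by (auto simp: max_def)
      ultimately have a: "P (max q p) (a q) \<le> (1 / 2) ^ (max q p + q)"
        by (simp add: T_tail)
      have "b q = (\<Sum>k\<in>(\<lambda>m. m - n) ` (E q \<inter> {n<..<K}). (S ^^ k) (y q))"
        unfolding b_def by (subst sum.reindex) (auto intro!: inj_onI)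
      moreover have "(\<lambda>m. m - n) ` (E q \<inter> {n<..<K}) \<subseteq> {N (max q p)..}"
        using E_sep[OF n, of _ q] by (auto simp: max_def)
      ultimately have b: "P (max q p) (b q) \<le> (1 / 2) ^ (max q p + q)"
        by (simp add: S_tail)
      have "P p (a q + b q) \<le> P (max q p) (a q + b q)"
        by (intro P_mono) simp
      also have "\<dots> \<le> 2 * (1 / 2) ^ (max q p + q)"
        using P_triangle[of "max q p" "a q" "b q"] a b by linarith
      finally show "P p (a q + b q) \<le> 2 * (1 / 2) ^ (max q p + q)" .
    qed
    also have "\<dots> \<le> 4 * (1 / 2) ^ p"
      using sum_half_power_le[of p K] by (simp flip: sum_distrib_left)
    finally show ?thesis .
  qed
  have "P p ((T ^^ n) x - y p) \<le> 4 * (1 / 2) ^ p" if n: "n \<in> E p" for p n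
  proof (rule field_le_epsilon)
    fix e :: real assume e: "0 < e"
    have "(\<lambda>K. (T ^^ n) (u K)) \<longlonglongrightarrow> (T ^^ n) x"
      using continuous_on_tendsto_compose[OF Tn_cont x] by simp
    then have "\<forall>\<^sub>F K in sequentially. P p ((T ^^ n) (u K) - (T ^^ n) x) < e"
      using e by (rule eventually_P_less)
    then obtain K where K: "n < K" "P p ((T ^^ n) (u K) - (T ^^ n) x) < e"
      using eventually_gt_at_top[of n]
      by (metis (mono_tags, lifting) eventually_conj eventually_happens' sequentially_bot)
    then show "P p ((T ^^ n) x - y p) \<le> 4 * (1 / 2) ^ p + e"
      using near[OF n K(1)] P_triangle3[of p "(T ^^ n) x" "y p" "(T ^^ n) (u K)"]
        P_minus_commute[of p "(T ^^ n) x"] by simp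
  qed
  then show ?thesis by blast
qed

text \<open>
  The target \<open>y p\<close> is chosen in \<open>X0\<close> within \<open>(1 / 2) ^ p\<close>, for \<open>P p\<close>, of the point of a countable
  dense set whose number is the first component of \<open>prod_decode p\<close>. Each point of that set is
  thus approximated by infinitely many targets, with errors tending to 0.
\<close>

theorem frequently_hypercyclic_criterion:
  fixes T S :: "'a \<Rightarrow> 'a" and \<alpha> :: "nat \<Rightarrow> real"
  assumes pos: "\<And>k. 0 < \<alpha> k"
    and ratio: "(\<lambda>k. \<alpha> (Suc k) / \<alpha> k) \<longlonglongrightarrow> 1"
    and div: "filterlim (\<lambda>n. \<Sum>k=1..n. \<alpha> k) at_top sequentially"
    and sep: "separable_space (euclidean :: 'a topology)"
    and T_add: "\<And>x y. T (x + y) = T x + T y"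
    and T_cont: "continuous_on UNIV T"
    and dense: "closure X0 = UNIV"
    and S: "S \<in> X0 \<rightarrow> X0"
    and T_summable: "\<And>x. x \<in> X0 \<Longrightarrow> (\<lambda>n. (T ^^ n) x) summable_on (UNIV :: nat set)"
    and S_summable: "\<And>x. x \<in> X0 \<Longrightarrow> (\<lambda>n. (S ^^ n) x) summable_on (UNIV :: nat set)"
    and TS: "\<And>x. x \<in> X0 \<Longrightarrow> T (S x) = x"
  shows "frequently_hypercyclic (admissible_matrix \<alpha>) T"
proof -
  obtain C :: "'a set" where C: "countable C" "closure C = UNIV"
    using sep by (auto simp: separable_space_def)
  then have "C \<noteq> {}" by auto
  define c where "c = from_nat_into C"
  have range_c: "range c = C"
    unfolding c_def using \<open>C \<noteq> {}\<close> C(1) by (rule range_from_nat_into)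
  have "\<exists>z\<in>X0. P p (z - c (fst (prod_decode p))) < (1 / 2) ^ p" for p
  proof -
    let ?V = "{z. P p (z - c (fst (prod_decode p))) < (1 / 2) ^ p}"
    have "c (fst (prod_decode p)) \<in> ?V" by (simp add: P_zero)
    then have "?V \<inter> closure X0 \<noteq> {}"
      unfolding dense by blast
    then have "?V \<inter> X0 \<noteq> {}"
      unfolding open_Int_closure_eq_empty[OF open_P_ball] .
    then show ?thesis by auto
  qed
  then obtain y where y: "\<And>p. y p \<in> X0" "\<And>p. P p (y p - c (fst (prod_decode p))) < (1 / 2) ^ p"
    by metis
  have "\<exists>M. \<forall>F. finite F \<and> F \<subseteq> {M..} \<longrightarrow> P r (\<Sum>m\<in>F. (T ^^ m) (y q)) < (1 / 2) ^ (r + q)" for r q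
    using T_summable[OF y(1)] by (intro summable_on_small_tails) auto
  then obtain NT where NT: "\<And>r q F. finite F \<Longrightarrow> F \<subseteq> {NT r q..} \<Longrightarrow>
      P r (\<Sum>m\<in>F. (T ^^ m) (y q)) < (1 / 2) ^ (r + q)"
    by metis
  have "\<exists>M. \<forall>F. finite F \<and> F \<subseteq> {M..} \<longrightarrow> P r (\<Sum>m\<in>F. (S ^^ m) (y q)) < (1 / 2) ^ (r + q)" for r q
    using S_summable[OF y(1)] by (intro summable_on_small_tails) auto
  then obtain NS where NS: "\<And>r q F. finite F \<Longrightarrow> F \<subseteq> {NS r q..} \<Longrightarrow>
      P r (\<Sum>m\<in>F. (S ^^ m) (y q)) < (1 / 2) ^ (r + q)"
    by metis
  define N where "N r = Suc r + (\<Sum>q\<le>r. NT r q + NS r q)" for r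
  have N_ge: "NT r q \<le> N r" "NS r q \<le> N r" if "q \<le> r" for r q
  proof -
    have "NT r q + NS r q \<le> (\<Sum>q\<le>r. NT r q + NS r q)"
      using that by (intro member_le_sum) auto
    then show "NT r q \<le> N r" "NS r q \<le> N r" by (simp_all add: N_def)
  qed
  obtain E where E_ge: "\<And>p n. n \<in> E p \<Longrightarrow> N p \<le> n"
    and E_disj: "\<And>p q n. n \<in> E p \<Longrightarrow> n \<in> E q \<Longrightarrow> p = q"
    and E_sep: "\<And>p q n m. n \<in> E p \<Longrightarrow> m \<in> E q \<Longrightarrow> n < m \<Longrightarrow> N p \<le> m - n \<and> N q \<le> m - n"
    and E_density: "\<And>p. 0 < lower_density (admissible_matrix \<alpha>) (E p)"
    using separated_sets_of_positive_lower_density[OF pos ratio div] by metis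
  have "\<exists>x. \<forall>p. \<forall>n\<in>E p. P p ((T ^^ n) x - y p) \<le> 4 * (1 / 2) ^ p"
  proof (rule orbit_near_targets[OF T_add T_cont _ _ _ _ _ E_ge E_disj E_sep])
    show "(T ^^ n) ((S ^^ m) (y q)) = (T ^^ (n - m)) (y q)" if "m \<le> n" for m n q
      using funpow_right_inverse(1)[OF S TS y(1)] that by simp
    show "(T ^^ n) ((S ^^ m) (y q)) = (S ^^ (m - n)) (y q)" if "n \<le> m" for m n q
      using funpow_right_inverse(2)[OF S TS y(1)] that by simp
    show "r < N r" for r by (simp add: N_def)
    show "P r (\<Sum>m\<in>F. (T ^^ m) (y q)) \<le> (1 / 2) ^ (r + q)"
      if "q \<le> r" "finite F" "F \<subseteq> {N r..}" for r q F
      using N_ge(1)[OF that(1)] that(2,3)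
      by (intro less_imp_le[OF NT]) (auto intro: order_trans)
    show "P r (\<Sum>m\<in>F. (S ^^ m) (y q)) \<le> (1 / 2) ^ (r + q)"
      if "q \<le> r" "finite F" "F \<subseteq> {N r..}" for r q F
      using N_ge(2)[OF that(1)] that(2,3)
      by (intro less_imp_le[OF NS]) (auto intro: order_trans)
  qed
  then obtain x where x: "\<And>p n. n \<in> E p \<Longrightarrow> P p ((T ^^ n) x - y p) \<le> 4 * (1 / 2) ^ p"
    by blast
  have "0 < lower_density (admissible_matrix \<alpha>) (return_set T x U)" if U: "open U" "U \<noteq> {}" for U
  proof -
    have "U \<inter> C \<noteq> {}"
      using open_Int_closure_eq_empty[OF U(1), of C] C(2) U(2) by auto
    then obtain a where a: "c a \<in> U" using range_c by auto
    then obtain i e where e: "0 < e" "\<And>z. P i (z - c a) < e \<Longrightarrow> z \<in> U"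
      using U(1) unfolding open_iff by blast
    have "(\<lambda>b. 5 * (1 / 2 :: real) ^ b) \<longlonglongrightarrow> 0" by real_asymp
    then have "\<forall>\<^sub>F b in sequentially. 5 * (1 / 2 :: real) ^ b < e"
      using e(1) by (rule order_tendstoD)
    then obtain b where b: "i \<le> b" "5 * (1 / 2 :: real) ^ b < e"
      using eventually_ge_at_top[of i]
      by (metis (mono_tags, lifting) eventually_conj eventually_happens' sequentially_bot)
    define p where "p = prod_encode (a, b)"
    have p: "b \<le> p" "fst (prod_decode p) = a"
      by (simp_all add: p_def le_prod_encode_2)
    have "E p \<subseteq> return_set T x U"
    proof
      fix n assume n: "n \<in> E p"
      have "P i ((T ^^ n) x - c a) \<le> P p ((T ^^ n) x - c a)"
        using p(1) b(1) by (intro P_mono) simp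
      also have "\<dots> \<le> P p ((T ^^ n) x - y p) + P p (y p - c a)"
        by (rule P_triangle3)
      also have "\<dots> \<le> 5 * (1 / 2) ^ p"
        using x[OF n] y(2)[of p] p(2) by simp
      also have "\<dots> \<le> 5 * (1 / 2) ^ b"
        using p(1) by (intro mult_left_mono power_decreasing) auto
      finally have "(T ^^ n) x \<in> U" using b(2) by (intro e(2)) simp
      then show "n \<in> return_set T x U"
        using E_ge[OF n] by (simp add: return_set_def N_def)
    qed
    then have "lower_density (admissible_matrix \<alpha>) (E p)
        \<le> lower_density (admissible_matrix \<alpha>) (return_set T x U)"
      using pos by (intro lower_density_admissible_mono) (auto intro: less_imp_le)
    then show ?thesis using E_density[of p] by (rule less_le_trans[rotated])
  qed
  then show ?thesis unfolding frequently_hypercyclic_def by blast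
qed

end

theorem proposition3p5:
  fixes scl :: "'k::real_normed_field \<Rightarrow> 'a::{ab_group_add,topological_space} \<Rightarrow> 'a"
    and T S :: "'a \<Rightarrow> 'a"
    and X0 :: "'a set"
  assumes "frechet_space scl"
    and "separable_space (euclidean :: 'a topology)"
    and "Vector_Spaces.linear scl scl T"
    and "continuous_on UNIV T"
    and "closure X0 = UNIV"
    and "S \<in> X0 \<rightarrow> X0"
    and "\<And>x. x \<in> X0 \<Longrightarrow> (\<lambda>n. (T ^^ n) x) summable_on (UNIV :: nat set)"
    and "\<And>x. x \<in> X0 \<Longrightarrow> (\<lambda>n. (S ^^ n) x) summable_on (UNIV :: nat set)"
    and "\<And>x. x \<in> X0 \<Longrightarrow> T (S x) = x"
  shows "frequently_hypercyclic B2 T"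
proof -
  obtain P :: "nat \<Rightarrow> 'a \<Rightarrow> real" where P: "graded_seminormed_group P"
    using frechet_space.graded_seminormed_group[OF assms(1)] by blast
  have add: "T (x + y) = T x + T y" for x y
    using assms(3) by (simp add: Vector_Spaces.linear_iff)
  have div: "filterlim (\<lambda>n. \<Sum>k=1..n. B2_weight k) at_top sequentially"
    using admissible_weights_B2 by (simp add: admissible_weights_def)
  show ?thesis
    unfolding B2_def
    by (rule graded_seminormed_group.frequently_hypercyclic_criterion
        [OF P B2_weight_pos B2_weight_ratio div assms(2) add assms(4-9)])
qed

end
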